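(* Let $X$ be a small loop space. Then for every $x\in X$, the topological fundamental group $\pi_1^{top}(X,x)$ has the trivial (indiscrete) topology.
   Context: For a pointed space $(X,x)$, $\Omega(X,x)$ is the space of loops $(I,\partial I)\to(X,x)$ with the compact-open topology, and $\pi_1^{top}(X,x)$ is the fundamental group $\pi_1(X,x)$ with the quotient topology from the surjection $\Omega(X,x)\to\pi_1(X,x)$, $\alpha\mapsto[\alpha]$. A loop $\alpha:(I,\partial I)\to(X,x)$ is small if for every open neighborhood $U$ of $x$ there is a representative of the homotopy class $[\alpha]\in\pi_1(X,x)$ with image in $U$. A non-simply connected space $X$ is a small loop space if for every $x\in X$ every loop $\alpha:(I,\partial I)\to(X,x)$ is small. *)

theory Defs
  imports "HOL-Analysis.Analysis" "HOL-Algebra.Group"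
begin

definition indiscrete_topology :: "'a set \<Rightarrow> 'a topology" where
  "indiscrete_topology S = topology (\<lambda>U. U = {} \<or> U = S)"

lemma openin_indiscrete_topology:
  "openin (indiscrete_topology S) U \<longleftrightarrow> U = {} \<or> U = S"
proof -
  have "istopology (\<lambda>U. U = {} \<or> U = S)"
    unfolding istopology_def by blast
  then show ?thesis
    by (simp add: indiscrete_topology_def topology_inverse')
qed

definition quotient_topology :: "'a topology \<Rightarrow> ('a \<Rightarrow> 'b) \<Rightarrow> 'b topology" where
  "quotient_topology X f =
     topology (\<lambda>U. U \<subseteq> f ` topspace X \<and> openin X {x \<in> topspace X. f x \<in> U})"

lemma openin_quotient_topology:
  "openin (quotient_topology X f) U \<longleftrightarrow>
     U \<subseteq> f ` topspace X \<and> openin X {x \<in> topspace X. f x \<in> U}"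
proof -
  have "istopology (\<lambda>U. U \<subseteq> f ` topspace X \<and> openin X {x \<in> topspace X. f x \<in> U})"
    unfolding istopology_def
  proof (rule conjI; intro allI impI)
    fix S T
    assume "S \<subseteq> f ` topspace X \<and> openin X {x \<in> topspace X. f x \<in> S}"
      and "T \<subseteq> f ` topspace X \<and> openin X {x \<in> topspace X. f x \<in> T}"
    moreover have "{x \<in> topspace X. f x \<in> S \<inter> T} =
        {x \<in> topspace X. f x \<in> S} \<inter> {x \<in> topspace X. f x \<in> T}"
      by blast
    ultimately show "S \<inter> T \<subseteq> f ` topspace X \<and> openin X {x \<in> topspace X. f x \<in> S \<inter> T}"
      by auto
  next
    fix \<K>
    assume K: "\<forall>S\<in>\<K>. S \<subseteq> f ` topspace X \<and> openin X {x \<in> topspace X. f x \<in> S}"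
    have "{x \<in> topspace X. f x \<in> \<Union>\<K>} = (\<Union>S\<in>\<K>. {x \<in> topspace X. f x \<in> S})"
      by blast
    then show "\<Union>\<K> \<subseteq> f ` topspace X \<and> openin X {x \<in> topspace X. f x \<in> \<Union>\<K>}"
      using K by auto
  qed
  then show ?thesis
    by (simp add: quotient_topology_def topology_inverse')
qed

lemma topspace_quotient_topology: "topspace (quotient_topology X f) = f ` topspace X"
proof -
  have "{x \<in> topspace X. f x \<in> f ` topspace X} = topspace X"
    by blast
  then have "openin (quotient_topology X f) (f ` topspace X)"
    by (simp add: openin_quotient_topology)
  then show ?thesis
    by (meson openin_quotient_topology openin_subset openin_topspace subset_antisym)
qed

lemma quotient_map_quotient_topology: "quotient_map X (quotient_topology X f) f"
  by (simp add: quotient_map_def topspace_quotient_topology openin_quotient_topology)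

text \<open>The points are the continuous maps \<open>X \<rightarrow> Y\<close>, made extensional so that
  maps agreeing on \<open>topspace X\<close> are equal.\<close>

definition compact_open_topology :: "'a topology \<Rightarrow> 'b topology \<Rightarrow> ('a \<Rightarrow> 'b) topology" where
  "compact_open_topology X Y = topology_generated_by
     {{f \<in> extensional (topspace X). continuous_map X Y f \<and> f ` K \<subseteq> U} | K U.
        compactin X K \<and> openin Y U}"

lemma topspace_compact_open_topology:
  "topspace (compact_open_topology X Y) = {f \<in> extensional (topspace X). continuous_map X Y f}"
proof -
  have "{f \<in> extensional (topspace X). continuous_map X Y f} =
      {f \<in> extensional (topspace X). continuous_map X Y f \<and> f ` {} \<subseteq> topspace Y}"
    by simp
  then show ?thesis
    unfolding compact_open_topology_def topology_generated_by_topspace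
    using compactin_empty openin_topspace by blast
qed

abbreviation unit_interval :: "real topology" where
  "unit_interval \<equiv> top_of_set {0..1}"

definition loop_space :: "'a topology \<Rightarrow> 'a \<Rightarrow> (real \<Rightarrow> 'a) topology" where
  "loop_space X x =
     subtopology (compact_open_topology unit_interval X) {\<alpha>. \<alpha> 0 = x \<and> \<alpha> 1 = x}"

abbreviation loops :: "'a topology \<Rightarrow> 'a \<Rightarrow> (real \<Rightarrow> 'a) set" where
  "loops X x \<equiv> topspace (loop_space X x)"

lemma loops_iff:
  "\<alpha> \<in> loops X x \<longleftrightarrow> \<alpha> \<in> extensional {0..1} \<and> pathin X \<alpha> \<and> \<alpha> 0 = x \<and> \<alpha> 1 = x"
  by (auto simp: loop_space_def topspace_compact_open_topology pathin_def)

definition loop_class :: "'a topology \<Rightarrow> 'a \<Rightarrow> (real \<Rightarrow> 'a) \<Rightarrow> (real \<Rightarrow> 'a) set" where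
  "loop_class X x \<alpha> =
     {\<beta> \<in> loops X x. homotopic_with (\<lambda>\<gamma>. \<gamma> 0 = x \<and> \<gamma> 1 = x) unit_interval X \<alpha> \<beta>}"

definition loop_concat :: "(real \<Rightarrow> 'a) \<Rightarrow> (real \<Rightarrow> 'a) \<Rightarrow> real \<Rightarrow> 'a" where
  "loop_concat \<alpha> \<beta> = (\<lambda>t\<in>{0..1}. if t \<le> 1/2 then \<alpha> (2 * t) else \<beta> (2 * t - 1))"

text \<open>The classes in the union below all coincide, since concatenation respects
  homotopy relative to the endpoints.\<close>

definition fundamental_group :: "'a topology \<Rightarrow> 'a \<Rightarrow> (real \<Rightarrow> 'a) set monoid" where
  "fundamental_group X x =
     \<lparr>carrier = loop_class X x ` loops X x,
      monoid.mult = (\<lambda>P Q. \<Union>\<alpha>\<in>P. \<Union>\<beta>\<in>Q. loop_class X x (loop_concat \<alpha> \<beta>)),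
      one = loop_class X x (\<lambda>t\<in>{0..1}. x)\<rparr>"

definition top_fundamental_group :: "'a topology \<Rightarrow> 'a \<Rightarrow> (real \<Rightarrow> 'a) set topology" where
  "top_fundamental_group X x = quotient_topology (loop_space X x) (loop_class X x)"

lemma topspace_top_fundamental_group:
  "topspace (top_fundamental_group X x) = carrier (fundamental_group X x)"
  by (simp add: top_fundamental_group_def fundamental_group_def topspace_quotient_topology)

definition simply_connected_space :: "'a topology \<Rightarrow> bool" where
  "simply_connected_space X \<longleftrightarrow> path_connected_space X \<and>
     (\<forall>x \<in> topspace X. carrier (fundamental_group X x) = {\<one>\<^bsub>fundamental_group X x\<^esub>})"

definition small_loop :: "'a topology \<Rightarrow> 'a \<Rightarrow> (real \<Rightarrow> 'a) \<Rightarrow> bool" where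
  "small_loop X x \<alpha> \<longleftrightarrow>
     (\<forall>U. openin X U \<and> x \<in> U \<longrightarrow> (\<exists>\<beta> \<in> loop_class X x \<alpha>. \<beta> ` {0..1} \<subseteq> U))"

definition small_loop_space :: "'a topology \<Rightarrow> bool" where
  "small_loop_space X \<longleftrightarrow> \<not> simply_connected_space X \<and>
     (\<forall>x \<in> topspace X. \<forall>\<alpha> \<in> loops X x. small_loop X x \<alpha>)"

end

theory Submission
  imports Defs
begin

text \<open>
  Let \<open>V\<close> be an open set of loops that contains \<open>\<gamma>\<close>, and let \<open>\<delta>\<close> be another loop at \<open>x\<close>.
  A compact-open neighbourhood of \<open>\<gamma>\<close> constrains a loop near the parameter \<open>0\<close> only by
  requiring its values there to lie in a neighbourhood \<open>U\<close> of \<open>x\<close>, so one may insert any loop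
  in \<open>U\<close> at the start of \<open>\<gamma>\<close> without leaving \<open>V\<close>. Inserting a small representative of the class
  \<open>[\<delta>][\<gamma>]\<^sup>-\<^sup>1\<close> gives a member of \<open>V\<close> in the class \<open>[\<delta>]\<close>. Hence every nonempty open set
  of classes contains every class.
\<close>

text \<open>Induction over the generation of the topology. A subbasic condition on a compact
  \<open>K\<close> constrains values near \<open>a\<close> only through \<open>U\<close> if
  \<open>a \<in> K\<close>, and not at all if \<open>a \<notin> K\<close>. That \<open>f\<close>
  itself maps \<open>N\<close> into \<open>U\<close> is carried along for the sake of
  intersections.\<close>

lemma compact_open_perturbation:
  assumes "openin (compact_open_topology X Y) V" and "f \<in> V"
    and a: "a \<in> topspace X" and X: "Hausdorff_space X"
  shows "\<exists>N U. openin X N \<and> a \<in> N \<and> openin Y U \<and> f ` N \<subseteq> U \<and>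
    (\<forall>g \<in> topspace (compact_open_topology X Y).
       g ` N \<subseteq> U \<and> (\<forall>t \<in> topspace X - N. g t = f t) \<longrightarrow> g \<in> V)"
proof -
  define perturbs where "perturbs V N U \<longleftrightarrow>
    openin X N \<and> a \<in> N \<and> openin Y U \<and> f ` N \<subseteq> U \<and>
    (\<forall>g \<in> topspace (compact_open_topology X Y).
       g ` N \<subseteq> U \<and> (\<forall>t \<in> topspace X - N. g t = f t) \<longrightarrow> g \<in> V)" for V N U
  let ?S = "{{f \<in> extensional (topspace X). continuous_map X Y f \<and> f ` K \<subseteq> U} | K U.
        compactin X K \<and> openin Y U}"
  have "generate_topology_on ?S V"
    using assms(1) unfolding compact_open_topology_def
    by (rule openin_topology_generated_by)
  then have "\<exists>N U. perturbs V N U"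
    using \<open>f \<in> V\<close>
  proof (induction rule: generate_topology_on.induct)
    case Empty
    then show ?case by simp
  next
    case (Int V1 V2)
    then obtain N1 U1 N2 U2 where p: "perturbs V1 N1 U1" "perturbs V2 N2 U2"
      by blast
    have 1: "openin X N1" "a \<in> N1" "openin Y U1" "f ` N1 \<subseteq> U1"
      and 2: "openin X N2" "a \<in> N2" "openin Y U2" "f ` N2 \<subseteq> U2"
      using p unfolding perturbs_def by blast+
    have "g \<in> V1 \<inter> V2"
      if g: "g \<in> topspace (compact_open_topology X Y)" "g ` (N1 \<inter> N2) \<subseteq> U1 \<inter> U2"
        "\<forall>t \<in> topspace X - (N1 \<inter> N2). g t = f t" for g
    proof -
      \<comment> \<open>On \<open>N1 - N2\<close> the map \<open>g\<close> equals \<open>f\<close>,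
        which sends all of \<open>N1\<close> into \<open>U1\<close>.\<close>
      have "g t \<in> U1" if "t \<in> N1" for t
        using that g(2,3) 1 openin_subset[OF 1(1)] by (cases "t \<in> N2") auto
      then have "g \<in> V1"
        using p(1) g(1,3) unfolding perturbs_def by blast
      have "g t \<in> U2" if "t \<in> N2" for t
        using that g(2,3) 2 openin_subset[OF 2(1)] by (cases "t \<in> N1") auto
      then have "g \<in> V2"
        using p(2) g(1,3) unfolding perturbs_def by blast
      with \<open>g \<in> V1\<close> show ?thesis by blast
    qed
    moreover have "f ` (N1 \<inter> N2) \<subseteq> U1 \<inter> U2"
      using 1 2 by blast
    ultimately have "perturbs (V1 \<inter> V2) (N1 \<inter> N2) (U1 \<inter> U2)"
      using 1 2 by (simp add: perturbs_def openin_Int)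
    then show ?case by blast
  next
    case (UN \<K>)
    then obtain k N U where k: "k \<in> \<K>" "perturbs k N U" by blast
    then have "perturbs (\<Union>\<K>) N U"
      unfolding perturbs_def by blast
    then show ?case by blast
  next
    case (Basis W)
    then obtain K U where K: "compactin X K" and U: "openin Y U"
      and W: "W = {f \<in> extensional (topspace X). continuous_map X Y f \<and> f ` K \<subseteq> U}"
      by blast
    have f: "continuous_map X Y f" "f ` K \<subseteq> U"
      using Basis.prems W by auto
    have KX: "K \<subseteq> topspace X"
      using K by (rule compactin_subset_topspace)
    show ?case
    proof (cases "a \<in> K")
      case True
      \<comment> \<open>This preimage contains \<open>K\<close>, so any map sending it into
        \<open>U\<close> also sends \<open>K\<close> into \<open>U\<close>.\<close>
      let ?N = "{t \<in> topspace X. f t \<in> U}"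
      have "openin X ?N"
        using f(1) U by (rule openin_continuous_map_preimage)
      moreover have "g \<in> W" if "g \<in> topspace (compact_open_topology X Y)" "g ` ?N \<subseteq> U" for g
        using that f KX by (auto simp: W topspace_compact_open_topology)
      ultimately have "perturbs W ?N U"
        using a f True U by (auto simp: perturbs_def)
      then show ?thesis by blast
    next
      case False
      \<comment> \<open>Compact sets are closed in a Hausdorff space. Values off \<open>K\<close>
        are free, hence the choice of \<open>topspace Y\<close> as target.\<close>
      let ?N = "topspace X - K"
      have "openin X ?N"
        using compactin_imp_closedin[OF X K] by (simp add: openin_diff)
      moreover have "g \<in> W" if g: "g \<in> topspace (compact_open_topology X Y)"
        "\<forall>t \<in> topspace X - ?N. g t = f t" for g
      proof -
        have "g t = f t" if "t \<in> K" for t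
          using that g(2) KX by blast
        then show ?thesis
          using g(1) f(2) by (auto simp: W topspace_compact_open_topology)
      qed
      moreover have "f ` ?N \<subseteq> topspace Y"
        using continuous_map_image_subset_topspace[OF f(1)] by blast
      ultimately have "perturbs W ?N (topspace Y)"
        using a False by (simp add: perturbs_def)
      then show ?thesis by blast
    qed
  qed
  then show ?thesis
    unfolding perturbs_def .
qed

text \<open>The minimum lets \<open>\<gamma>\<close> catch up at double speed during \<open>{e..2*e}\<close>, so that the splice
  coincides with \<open>\<gamma>\<close> from \<open>2*e\<close> on.\<close>

definition splice :: "real \<Rightarrow> (real \<Rightarrow> 'a) \<Rightarrow> (real \<Rightarrow> 'a) \<Rightarrow> real \<Rightarrow> 'a" where
  "splice e \<sigma> \<gamma> = (\<lambda>t\<in>{0..1}. if t \<le> e then \<sigma> (t / e) else \<gamma> (min (2 * t - 2 * e) t))"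

text \<open>Deform \<open>\<sigma>\<close> by its own homotopy, squeezed into \<open>{0..e}\<close>,
  and keep the part along \<open>\<gamma>\<close> fixed. The pieces fit at \<open>e\<close> since
  every stage of the homotopy ends at \<open>x\<close>, where \<open>\<gamma>\<close>
  starts.\<close>

lemma homotopic_splice:
  assumes e: "0 < e" "2 * e \<le> 1"
    and hom: "homotopic_with (\<lambda>\<gamma>. \<gamma> 0 = x \<and> \<gamma> 1 = x) unit_interval X \<sigma> \<sigma>'"
    and g: "pathin X \<gamma>" "\<gamma> 0 = x" "\<gamma> 1 = y"
  shows "homotopic_with (\<lambda>\<gamma>. \<gamma> 0 = x \<and> \<gamma> 1 = y) unit_interval X
    (splice e \<sigma> \<gamma>) (splice e \<sigma>' \<gamma>)"
proof -
  let ?T = "top_of_set ({0..1} \<times> {0..1}) :: (real \<times> real) topology"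
  have T: "prod_topology unit_interval unit_interval = ?T"
    by simp
  obtain h where h: "continuous_map ?T X h" "\<forall>t. h (0, t) = \<sigma> t" "\<forall>t. h (1, t) = \<sigma>' t"
    "\<forall>s\<in>{0..1}. h (s, 0) = x \<and> h (s, 1) = x"
    using hom unfolding homotopic_with_def T by blast
  let ?k = "\<lambda>p. if snd p \<le> e then (h \<circ> (\<lambda>p. (fst p, snd p / e))) p
                else (\<gamma> \<circ> (\<lambda>p. min (2 * snd p - 2 * e) (snd p))) p"
  have "continuous_map ?T X ?k"
  proof (rule continuous_map_cases_le)
    show "continuous_map ?T euclideanreal snd" "continuous_map ?T euclideanreal (\<lambda>p. e)"
      by (auto intro!: continuous_intros)
    show "continuous_map (subtopology ?T {p \<in> topspace ?T. snd p \<le> e}) X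
        (h \<circ> (\<lambda>p. (fst p, snd p / e)))"
      using e by (intro continuous_map_compose[OF _ h(1)])
        (auto simp: subtopology_subtopology intro!: continuous_intros)
    show "continuous_map (subtopology ?T {p \<in> topspace ?T. e \<le> snd p}) X
        (\<gamma> \<circ> (\<lambda>p. min (2 * snd p - 2 * e) (snd p)))"
      using e by (intro continuous_map_compose[OF _ g(1)[unfolded pathin_def]])
        (auto simp: subtopology_subtopology intro!: continuous_intros)
    show "(h \<circ> (\<lambda>p. (fst p, snd p / e))) p = (\<gamma> \<circ> (\<lambda>p. min (2 * snd p - 2 * e) (snd p))) p"
      if "p \<in> topspace ?T" "snd p = e" for p
      using that e h(4) g by auto
  qed
  then show ?thesis
    using e h g unfolding T[symmetric]
    by (subst homotopic_with, force, intro exI[of _ ?k]) (auto simp: splice_def)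
qed

lemma splice_loop:
  assumes "0 < e" "2 * e \<le> 1" "\<sigma> \<in> loops X x" "\<gamma> \<in> loops X x"
  shows "splice e \<sigma> \<gamma> \<in> loops X x"
proof -
  \<comment> \<open>The reflexive homotopy of \<open>\<sigma>\<close> gives one of the splice, from
    which continuity and endpoint values are read off.\<close>
  have "homotopic_with (\<lambda>\<gamma>. \<gamma> 0 = x \<and> \<gamma> 1 = x) unit_interval X (splice e \<sigma> \<gamma>) (splice e \<sigma> \<gamma>)"
    using assms by (intro homotopic_splice) (auto simp: loops_iff pathin_def)
  then show ?thesis
    using homotopic_with_imp_continuous_maps homotopic_with_imp_property
    by (fastforce simp: loops_iff pathin_def splice_def)
qed

lemma splice_image:
  assumes "0 < e" "\<sigma> ` {0..1} \<subseteq> U" "\<gamma> ` {0..2 * e} \<subseteq> U"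
  shows "splice e \<sigma> \<gamma> ` ({0..1} \<inter> {..2 * e}) \<subseteq> U"
proof clarsimp
  fix t assume t: "0 \<le> t" "t \<le> 1" "t \<le> 2 * e"
  then have "t / e \<in> {0..1}" if "t \<le> e"
    using that assms by auto
  \<comment> \<open>The minimum never exceeds \<open>t\<close>, so \<open>\<gamma>\<close> is read
    only at times up to \<open>2 * e\<close>.\<close>
  moreover have "min (2 * t - 2 * e) t \<in> {0..2 * e}" if "\<not> t \<le> e"
    using that t by auto
  ultimately show "splice e \<sigma> \<gamma> t \<in> U"
    using t assms unfolding splice_def by (auto simp: image_subset_iff)
qed

text \<open>A quotient in the sense of groups: it represents the product of the class of
  \<open>\<delta>\<close> with the inverse of the class of \<open>\<gamma>\<close>.\<close>

definition quotient_loop :: "(real \<Rightarrow> 'a) \<Rightarrow> (real \<Rightarrow> 'a) \<Rightarrow> real \<Rightarrow> 'a" where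
  "quotient_loop \<delta> \<gamma> = loop_concat \<delta> (\<lambda>t. \<gamma> (1 - t))"

text \<open>Both \<open>\<delta>\<close> and \<open>quotient_loop \<delta> \<gamma>\<close> spliced into \<open>\<gamma>\<close> factor through the path \<open>?F\<close> on \<open>{0..2}\<close> that
  runs \<open>\<delta>\<close> and then the reverse of \<open>\<gamma>\<close>, so a straight-line homotopy in \<open>{0..2}\<close> connects them.\<close>

lemma quotient_loop:
  assumes d: "\<delta> \<in> loops X x" and g: "\<gamma> \<in> loops X x"
  shows quotient_loop_in_loops: "quotient_loop \<delta> \<gamma> \<in> loops X x"
    and homotopic_splice_quotient_loop:
      "\<lbrakk>0 < e; 2 * e \<le> 1\<rbrakk> \<Longrightarrow> homotopic_with (\<lambda>\<gamma>. \<gamma> 0 = x \<and> \<gamma> 1 = x) unit_interval X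
         (splice e (quotient_loop \<delta> \<gamma>) \<gamma>) \<delta>"
proof -
  let ?F = "\<lambda>u. if u \<le> 1 then \<delta> u else (\<gamma> \<circ> (\<lambda>u. 2 - u)) u"
  have dg: "continuous_map unit_interval X \<delta>" "continuous_map unit_interval X \<gamma>"
    "\<delta> 0 = x" "\<delta> 1 = x" "\<gamma> 0 = x" "\<gamma> 1 = x" "\<delta> \<in> extensional {0..1}"
    using d g by (auto simp: loops_iff pathin_def)
  have F: "continuous_map (top_of_set {0..2}) X ?F"
  proof (rule continuous_map_cases_le)
    have "{0..2} \<inter> {u. 0 \<le> u \<and> u \<le> 2 \<and> u \<le> (1::real)} = {0..1}" by auto
    then show "continuous_map (subtopology (top_of_set {0..2})
        {u \<in> topspace (top_of_set {0..2}). u \<le> 1}) X \<delta>"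
      using dg by (simp add: subtopology_subtopology)
    show "continuous_map (subtopology (top_of_set {0..2})
        {u \<in> topspace (top_of_set {0..2}). 1 \<le> u}) X (\<gamma> \<circ> (\<lambda>u. 2 - u))"
      by (intro continuous_map_compose[OF _ dg(2)])
        (auto simp: subtopology_subtopology intro!: continuous_intros)
  qed (use dg in auto)
  have "continuous_map unit_interval X (?F \<circ> (\<lambda>t. 2 * t))"
    by (intro continuous_map_compose[OF _ F]) (auto intro!: continuous_intros)
  then have "continuous_map unit_interval X (quotient_loop \<delta> \<gamma>)"
    by (rule continuous_map_eq) (auto simp: quotient_loop_def loop_concat_def)
  then show "quotient_loop \<delta> \<gamma> \<in> loops X x"
    using dg by (auto simp: loops_iff pathin_def quotient_loop_def loop_concat_def)
  assume e: "0 < e" "2 * e \<le> 1"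
  \<comment> \<open>\<open>?p\<close> sweeps \<open>{0..2}\<close> during \<open>{0..e}\<close>,
    then turns back from \<open>2\<close>, which retraces \<open>\<gamma>\<close> forwards. It stops
    at \<open>1\<close> because \<open>2 * e \<le> 1\<close>, so it has the same endpoints as
    \<open>id\<close>.\<close>
  let ?p = "\<lambda>t. if t \<le> e then 2 * t / e else 2 - min (2 * t - 2 * e) t"
  have p: "continuous_map unit_interval euclideanreal ?p"
    by (rule continuous_map_cases_le) (use e in \<open>auto simp: subtopology_subtopology intro!: continuous_intros\<close>)
  have "continuous_on {0..1} ?p"
    using p by simp
  have p02: "?p t \<in> {0..2}" if "t \<in> {0..1}" for t
    using that e by (auto simp: field_simps)
  have "homotopic_with (\<lambda>q. q 0 = 0 \<and> q 1 = 1) unit_interval (top_of_set {0..2}) ?p id"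
    unfolding homotopic_with_def
  proof (intro exI conjI allI ballI)
    let ?h = "\<lambda>(s, t). (1 - s) * ?p t + s * t"
    have "continuous_on ({0..1} \<times> {0..1}) (\<lambda>z. ?p (snd z))"
      by (rule continuous_on_compose2[OF \<open>continuous_on {0..1} ?p\<close>]) (auto intro: continuous_intros)
    then have "continuous_on ({0..1} \<times> {0..1}) ?h"
      unfolding case_prod_unfold by (intro continuous_intros)
    moreover have "(1 - s) * ?p t + s * t \<in> {0..2}" if "s \<in> {0..1}" "t \<in> {0..1}" for s t
      using convexD[OF convex_real_interval(5) p02[OF that(2)], of t "1 - s" s] that by auto
    ultimately show "continuous_map (prod_topology unit_interval unit_interval) (top_of_set {0..2}) ?h"
      by auto
  qed (use e in auto)
  then have "homotopic_with (\<lambda>\<gamma>. \<gamma> 0 = x \<and> \<gamma> 1 = x) unit_interval X (?F \<circ> ?p) (?F \<circ> id)"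
    by (rule homotopic_with_compose_continuous_map_left[OF _ F]) (use dg in auto)
  \<comment> \<open>The homotopy is unpacked because its ends need to match the splice and
    \<open>\<delta>\<close> only on \<open>{0..1}\<close>.\<close>
  then obtain h where h: "continuous_map (prod_topology unit_interval unit_interval) X h"
    "\<forall>t. h (0, t) = (?F \<circ> ?p) t" "\<forall>t. h (1, t) = (?F \<circ> id) t"
    "\<forall>s\<in>{0..1}. h (s, 0) = x \<and> h (s, 1) = x"
    unfolding homotopic_with_def by blast
  have "(?F \<circ> ?p) t = splice e (quotient_loop \<delta> \<gamma>) \<gamma> t" if "t \<in> {0..1}" for t
  proof (cases "t \<le> e")
    case True
    then have "t / e \<in> {0..1}"
      using that e by auto
    with True that e show ?thesis
      by (simp add: splice_def quotient_loop_def loop_concat_def field_simps)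
  next
    case False
    define m where "m = min (2 * t - 2 * e) t"
    have "m \<le> 1"
      using that by (auto simp: m_def)
    \<comment> \<open>\<open>?F\<close> takes its \<open>\<delta>\<close> branch at
      \<open>2 - m\<close> only for \<open>m = 1\<close>, where both loops have the value
      \<open>x\<close>.\<close>
    then have "\<delta> (2 - m) = \<gamma> m" if "1 \<le> m"
      using that dg by (cases "m = 1") auto
    with False that show ?thesis
      by (simp add: splice_def flip: m_def)
  qed
  then show "homotopic_with (\<lambda>\<gamma>. \<gamma> 0 = x \<and> \<gamma> 1 = x) unit_interval X
         (splice e (quotient_loop \<delta> \<gamma>) \<gamma>) \<delta>"
    using h by (subst homotopic_with, force, intro exI[of _ h]) auto
qed

lemma open_loop_class_meets_all:
  assumes V: "openin (loop_space X x) V" and g: "\<gamma> \<in> V" and d: "\<delta> \<in> loops X x"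
    and small: "small_loop X x (quotient_loop \<delta> \<gamma>)"
  obtains \<beta> where "\<beta> \<in> V" "loop_class X x \<beta> = loop_class X x \<delta>"
proof -
  let ?P = "\<lambda>\<gamma>. \<gamma> 0 = x \<and> \<gamma> 1 = x"
  have gl: "\<gamma> \<in> loops X x"
    using V g openin_subset by blast
  obtain V' where V': "openin (compact_open_topology unit_interval X) V'"
    and VV': "V = V' \<inter> {\<alpha>. \<alpha> 0 = x \<and> \<alpha> 1 = x}"
    using V by (auto simp: loop_space_def openin_subtopology)
  have "\<gamma> \<in> V'"
    using g VV' by blast
  from compact_open_perturbation[OF V' this, of 0]
  obtain N U where N: "openin unit_interval N" "0 \<in> N" and U: "openin X U" "\<gamma> ` N \<subseteq> U"
    and NU: "\<And>\<beta>. \<lbrakk>\<beta> \<in> topspace (compact_open_topology unit_interval X); \<beta> ` N \<subseteq> U;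
                \<forall>t \<in> {0..1} - N. \<beta> t = \<gamma> t\<rbrakk> \<Longrightarrow> \<beta> \<in> V'"
    by (auto simp: Hausdorff_space_subtopology)
  obtain r where r: "r > 0" "ball 0 r \<inter> {0..1} \<subseteq> N"
    using N by (auto simp: openin_contains_ball)
  \<comment> \<open>The bound \<open>r / 4\<close> keeps \<open>{0..2 * e}\<close> inside the ball
    of radius \<open>r\<close>; the bound \<open>1 / 2\<close> leaves room for the catch-up.\<close>
  define e where "e = min (r / 4) (1 / 2)"
  have e: "0 < e" "2 * e \<le> 1" "2 * e < r"
    using r by (auto simp: e_def)
  have eN: "{0..2 * e} \<subseteq> N"
    using r(2) e by (auto simp: subset_iff)
  have "x \<in> U"
    using gl U N by (auto simp: loops_iff)
  then obtain \<sigma> where s: "\<sigma> \<in> loop_class X x (quotient_loop \<delta> \<gamma>)" and sU: "\<sigma> ` {0..1} \<subseteq> U"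
    using small U by (auto simp: small_loop_def)
  let ?b = "splice e \<sigma> \<gamma>"
  have sl: "\<sigma> \<in> loops X x" and hom: "homotopic_with ?P unit_interval X (quotient_loop \<delta> \<gamma>) \<sigma>"
    using s by (auto simp: loop_class_def)
  have b: "?b \<in> loops X x"
    using e sl gl by (intro splice_loop)
  have off: "?b t = \<gamma> t" if "t \<in> {0..1}" "2 * e \<le> t" for t
    using that e by (auto simp: splice_def)
  have "?b ` ({0..1} \<inter> {..2 * e}) \<subseteq> U"
    using e sU order_trans[OF image_mono[OF eN] U(2)] by (intro splice_image) auto
  then have on: "?b t \<in> U" if "t \<in> {0..1}" "t \<le> 2 * e" for t
    using that by auto
  have "?b \<in> V'"
  proof (rule NU)
    show "?b \<in> topspace (compact_open_topology unit_interval X)"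
      using b by (simp add: loop_space_def)
    show "?b ` N \<subseteq> U"
    \<comment> \<open>\<open>N\<close> may reach beyond \<open>2 * e\<close>, but there the splice
      is \<open>\<gamma>\<close>, which maps \<open>N\<close> into \<open>U\<close>.\<close>
    proof clarify
      fix t assume t: "t \<in> N"
      then have "t \<in> {0..1}"
        using openin_subset[OF N(1)] by auto
      then show "?b t \<in> U"
        using on[of t] off[of t] U t by (cases "t \<le> 2 * e") auto
    qed
    show "\<forall>t \<in> {0..1} - N. ?b t = \<gamma> t"
    proof
      fix t assume t: "t \<in> {0..1} - N"
      then have "2 * e \<le> t"
        using eN by (meson DiffD1 DiffD2 atLeastAtMost_iff in_mono linear)
      then show "?b t = \<gamma> t"
        using t off by blast
    qed
  qed
  then have "?b \<in> V"
    using b VV' by (auto simp: loops_iff)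
  \<comment> \<open>On classes, multiplying by \<open>\<gamma>\<close> cancels the inverse contained
    in \<open>\<sigma>\<close> and leaves \<open>\<delta>\<close>.\<close>
  moreover have "homotopic_with ?P unit_interval X (splice e (quotient_loop \<delta> \<gamma>) \<gamma>) ?b"
    using e hom gl by (intro homotopic_splice) (auto simp: loops_iff)
  then have "homotopic_with ?P unit_interval X ?b \<delta>"
    using homotopic_splice_quotient_loop[OF d gl e(1,2)]
    by (meson homotopic_with_symD homotopic_with_trans)
  then have "loop_class X x ?b = loop_class X x \<delta>"
    unfolding loop_class_def by (meson homotopic_with_symD homotopic_with_trans)
  ultimately show thesis
    by (rule that)
qed

theorem theorem6p9:
  fixes X :: "'a topology"
  assumes "small_loop_space X"
  shows "\<forall>x \<in> topspace X.
    top_fundamental_group X x = indiscrete_topology (carrier (fundamental_group X x))"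
proof
  fix x assume x: "x \<in> topspace X"
  let ?q = "loop_class X x"
  have "?q ` loops X x \<subseteq> W"
    if W: "openin (top_fundamental_group X x) W" "W \<noteq> {}" for W
  proof clarify
    fix \<delta> assume d: "\<delta> \<in> loops X x"
    \<comment> \<open>Membership in \<open>?V\<close> depends only on the class, so one member in
      the class of \<open>\<delta>\<close> suffices.\<close>
    let ?V = "{\<alpha> \<in> loops X x. ?q \<alpha> \<in> W}"
    have "W \<subseteq> ?q ` loops X x" and V: "openin (loop_space X x) ?V"
      using W(1) by (auto simp: top_fundamental_group_def openin_quotient_topology)
    then obtain \<gamma> where g: "\<gamma> \<in> ?V"
      using W(2) by blast
    then have "small_loop X x (quotient_loop \<delta> \<gamma>)"
      using assms x quotient_loop_in_loops[OF d] by (auto simp: small_loop_space_def)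
    from open_loop_class_meets_all[OF V g d this] show "?q \<delta> \<in> W"
      by auto
  qed
  then have "openin (top_fundamental_group X x) W \<longleftrightarrow>
      openin (indiscrete_topology (carrier (fundamental_group X x))) W" for W
    using openin_subset[of "top_fundamental_group X x" W]
      openin_topspace[of "top_fundamental_group X x"]
    by (auto simp: openin_indiscrete_topology topspace_top_fundamental_group
        fundamental_group_def)
  then show "top_fundamental_group X x = indiscrete_topology (carrier (fundamental_group X x))"
    by (simp add: topology_eq)
qed

end
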